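(* For all positive integers $p$ and $g$ there exists a split graph $G$ of order $n = 3g + 2p - 2$ with $\gamma_p(G) = g$ and $rad_p(G) = p$; in particular $rad_p(G) = \frac{n - 3\gamma_p(G)}{2} + 1$.
   Context: All graphs are finite, simple, undirected and non-empty. A split graph is a graph whose vertex set can be partitioned into an independent set and a set inducing a clique. Here the split graphs considered are connected, with a vertex partition $V(G) = C \sqcup I$ in which $C$ and $I$ are non-empty, $C$ induces a maximum clique of $G$, and $I$ is an independent set. For a graph $G$ and $S \subseteq V(G)$, define $P^1_G(S) = N[S]$ (the closed neighbourhood of $S$), and for $i \geq 1$ let $V^i = \{v \in P^i_G(S) : |N[v] \setminus P^i_G(S)| \leq 1\}$ and $P^{i+1}_G(S) = P^i_G(S) \cup N[V^i]$. The set $S$ is a power dominating set (PDS) of $G$ if $P^i_G(S) = V(G)$ for some $i \ge 1$. The power domination number $\gamma_p(G)$ is the minimum cardinality of a PDS of $G$. For a PDS $S$, $rad_p(G,S) = \min\{i \geq 1 : P^i_G(S) = V(G)\}$. The propagation radius of $G$ is $rad_p(G) = \min\{rad_p(G,S) : S \text{ is a PDS of } G \text{ with } |S| = \gamma_p(G)\}$. *)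

theory Defs
  imports
    Complex_Main
    "Graph_Theory.Pair_Digraph"
    "Graph_Theory.Digraph_Component"
begin

text \<open>
  A finite simple undirected graph is a \<^const>\<open>pair_graph\<close>: a finite loop-free digraph whose arc
  relation is symmetric, so that each edge is represented by its two orientations.
\<close>

definition closed_nbhd :: "'a pair_pre_digraph \<Rightarrow> 'a \<Rightarrow> 'a set" where
  "closed_nbhd G v = insert v {u. (v, u) \<in> parcs G}"

definition closed_nbhd_set :: "'a pair_pre_digraph \<Rightarrow> 'a set \<Rightarrow> 'a set" where
  "closed_nbhd_set G S = (\<Union>v\<in>S. closed_nbhd G v)"

definition clique :: "'a pair_pre_digraph \<Rightarrow> 'a set \<Rightarrow> bool" where
  "clique G K \<longleftrightarrow> K \<subseteq> pverts G \<and> (\<forall>u\<in>K. \<forall>v\<in>K. u \<noteq> v \<longrightarrow> (u, v) \<in> parcs G)"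

definition maximum_clique :: "'a pair_pre_digraph \<Rightarrow> 'a set \<Rightarrow> bool" where
  "maximum_clique G K \<longleftrightarrow> clique G K \<and> (\<forall>K'. clique G K' \<longrightarrow> card K' \<le> card K)"

definition independent_set :: "'a pair_pre_digraph \<Rightarrow> 'a set \<Rightarrow> bool" where
  "independent_set G I \<longleftrightarrow> I \<subseteq> pverts G \<and> (\<forall>u\<in>I. \<forall>v\<in>I. (u, v) \<notin> parcs G)"

definition split_partition :: "'a pair_pre_digraph \<Rightarrow> 'a set \<Rightarrow> 'a set \<Rightarrow> bool" where
  "split_partition G C I \<longleftrightarrow>
     pverts G = C \<union> I \<and> C \<inter> I = {} \<and> C \<noteq> {} \<and> I \<noteq> {} \<and>
     maximum_clique G C \<and> independent_set G I"

definition connected_split_graph :: "'a pair_pre_digraph \<Rightarrow> bool" where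
  "connected_split_graph G \<longleftrightarrow>
     pair_graph G \<and> Digraph_Component.connected (with_proj G) \<and> (\<exists>C I. split_partition G C I)"

definition propagating :: "'a pair_pre_digraph \<Rightarrow> 'a set \<Rightarrow> 'a set" where
  "propagating G P = {v \<in> P. card (closed_nbhd G v - P) \<le> 1}"

text \<open>
  The sets $P^i_G(S)$. They are only defined for \<open>i \<ge> 1\<close>; the value at \<open>0\<close> is a dummy, and every
  definition below restricts to \<open>i \<ge> 1\<close>.
\<close>

fun observed :: "'a pair_pre_digraph \<Rightarrow> 'a set \<Rightarrow> nat \<Rightarrow> 'a set" where
  "observed G S 0 = {}"
| "observed G S (Suc 0) = closed_nbhd_set G S"
| "observed G S (Suc (Suc i)) =
     observed G S (Suc i) \<union> closed_nbhd_set G (propagating G (observed G S (Suc i)))"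

definition power_dominating_set :: "'a pair_pre_digraph \<Rightarrow> 'a set \<Rightarrow> bool" where
  "power_dominating_set G S \<longleftrightarrow> S \<subseteq> pverts G \<and> (\<exists>i\<ge>1. observed G S i = pverts G)"

text \<open>
  The minima below range over non-empty sets of natural numbers for every finite graph, since
  \<^term>\<open>pverts G\<close> is a power dominating set.
\<close>

definition power_domination_number :: "'a pair_pre_digraph \<Rightarrow> nat" where
  "power_domination_number G = (LEAST k. \<exists>S. power_dominating_set G S \<and> card S = k)"

definition pds_radius :: "'a pair_pre_digraph \<Rightarrow> 'a set \<Rightarrow> nat" where
  "pds_radius G S = (LEAST i. i \<ge> 1 \<and> observed G S i = pverts G)"

definition propagation_radius :: "'a pair_pre_digraph \<Rightarrow> nat" where
  "propagation_radius G =
     (LEAST r. \<exists>S. power_dominating_set G S \<and> card S = power_domination_number G \<and>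
                   pds_radius G S = r)"

end

theory Submission
  imports Defs
begin

text \<open>
  The graph consists of a clique with $g$ vertices $a_i$ and $m = p - 1$ vertices $b_k$; every $a_i$
  has two private leaves, and independent vertices $x_0, \ldots, x_{m-1}$ form a half graph with the
  $b_k$: $x_j$ is adjacent to $b_k$ iff $j \le k$. A power dominating set has to meet each
  triple formed by $a_i$ and its leaves, for otherwise the two leaves block each other. Hence a set
  of size $g$ lies inside the triples and observes no $x_j$ in the domination step; from then on
  every step observes at most one further $x_j$, as $b_k$ cannot propagate while two of
  $x_0, \ldots, x_k$ are missing. Starting with all the $a_i$, exactly one $x_j$ is gained per step.
\<close>

section \<open>Observation and propagation steps\<close>

lemma closed_nbhd_set_iff:
  "v \<in> closed_nbhd_set G S \<longleftrightarrow> v \<in> S \<or> (\<exists>u\<in>S. (u, v) \<in> parcs G)"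
  by (auto simp: closed_nbhd_set_def closed_nbhd_def)

lemma observed_Suc:
  "i \<ge> 1 \<Longrightarrow> observed G S (Suc i) =
    observed G S i \<union> closed_nbhd_set G (propagating G (observed G S i))"
  by (cases i) simp_all

lemma observed_subset_pverts:
  assumes "pair_wf_digraph G" "S \<subseteq> pverts G"
  shows "observed G S i \<subseteq> pverts G"
proof -
  have nb: "closed_nbhd_set G T \<subseteq> pverts G" if "T \<subseteq> pverts G" for T
    using that pair_wf_digraph.in_arcsD2[OF assms(1)] by (auto simp: closed_nbhd_set_iff)
  show ?thesis
  proof (induction i)
    case (Suc i)
    have "propagating G (observed G S i) \<subseteq> pverts G"
      using Suc by (auto simp: propagating_def)
    then show ?case
      using Suc nb assms(2) by (cases i) auto
  qed simp
qed

text \<open>Meant for showing that a vertex stays unobserved: a newly observed vertex has a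
  propagating neighbour. A propagating vertex itself is already observed and falls under the first
  case.\<close>

lemma observed_Suc_cases [consumes 2, case_names observed propagated]:
  assumes "v \<in> observed G S (Suc i)" "i \<ge> 1"
  obtains "v \<in> observed G S i"
  | u where "u \<in> observed G S i" "(u, v) \<in> parcs G"
      "card (closed_nbhd G u - observed G S i) \<le> 1"
  using assms by (auto simp: observed_Suc closed_nbhd_set_iff propagating_def)

lemma not_propagating:
  assumes "pair_fin_digraph G" "{x, y} \<subseteq> closed_nbhd G u - P" "x \<noteq> y"
  shows "\<not> card (closed_nbhd G u - P) \<le> 1"
proof -
  \<comment> \<open>Finiteness matters: an infinite set has \<open>card\<close> 0 and would pass the
    test.\<close>
  have "closed_nbhd G u \<subseteq> insert u (snd ` parcs G)"
    by (force simp: closed_nbhd_def)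
  then have "finite (closed_nbhd G u - P)"
    using pair_fin_digraph.pair_finite_arcs[OF assms(1)]
    by (meson finite_Diff finite_imageI finite_insert finite_subset)
  from card_mono[OF this assms(2)] assms(3) show ?thesis
    by simp
qed

text \<open>
  A clique that uses an independent vertex \<open>y\<close> loses a vertex of \<open>C\<close> not adjacent to \<open>y\<close>, so
  \<open>C\<close> is a maximum clique.
\<close>

lemma split_partitionI:
  assumes V: "pverts G = C \<union> I" "C \<inter> I = {}" "C \<noteq> {}" "I \<noteq> {}" and fin: "finite C"
    and C: "clique G C" and I: "independent_set G I"
    and miss: "\<And>y. y \<in> I \<Longrightarrow> \<exists>c\<in>C. (y, c) \<notin> parcs G"
  shows "split_partition G C I"
proof -
  have "card K \<le> card C" if K: "clique G K" for K
  proof (cases "K \<subseteq> C")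
    case True
    then show ?thesis using fin by (simp add: card_mono)
  next
    case False
    then obtain y where y: "y \<in> K" "y \<in> I"
      using K V by (auto simp: clique_def)
    then obtain c where c: "c \<in> C" "(y, c) \<notin> parcs G"
      using miss by blast
    \<comment> \<open>All other vertices of \<open>K\<close> are adjacent to \<open>y\<close>, so
      they avoid both \<open>I\<close> and \<open>c\<close>.\<close>
    have "K \<subseteq> insert y (C - {c})"
    proof
      fix x assume x: "x \<in> K"
      have "(y, x) \<in> parcs G" if "x \<noteq> y"
        using K x y that by (auto simp: clique_def)
      moreover have "x \<in> C \<union> I"
        using K x V(1) by (auto simp: clique_def)
      ultimately show "x \<in> insert y (C - {c})"
        using y(2) c(2) I by (auto simp: independent_set_def)
    qed
    then have "card K \<le> card (insert y (C - {c}))"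
      using fin by (simp add: card_mono)
    also have "\<dots> \<le> Suc (card (C - {c}))"
      by (simp add: card_insert_if fin)
    also have "\<dots> = card C"
      using fin c(1) by (rule card_Suc_Diff1)
    finally show ?thesis .
  qed
  then show ?thesis
    using V C I by (auto simp: split_partition_def maximum_clique_def)
qed

section \<open>The extremal graph is a connected split graph\<close>

text \<open>
  Numbering: $a_i = i$ and $b_k = g + k$ form the clique, $x_j = g + m + j$, and the leaves of
  $a_i$ are $g + 2m + i$ and $2g + 2m + i$.
\<close>

definition fwd_edge :: "nat \<Rightarrow> nat \<Rightarrow> nat \<Rightarrow> nat \<Rightarrow> bool" where
  "fwd_edge g m u v \<longleftrightarrow> u < v \<and>
     (v < g + m \<or> g \<le> u \<and> u < g + m \<and> v \<le> u + m \<or>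
      u < g \<and> (v = g + 2 * m + u \<or> v = 2 * g + 2 * m + u))"

text \<open>Since \<open>fwd_edge\<close> lists each edge once, from the smaller to the larger
  number, symmetrizing it creates no loops. Its disjunct \<open>v \<le> u + m\<close> yields the
  half graph: $g + m + j \<le> (g + k) + m$ iff $j \<le> k$.\<close>

definition ext_graph :: "nat \<Rightarrow> nat \<Rightarrow> nat pair_pre_digraph" where
  "ext_graph g m =
     \<lparr> pverts = {..<3 * g + 2 * m}, parcs = {(u, v). fwd_edge g m u v \<or> fwd_edge g m v u} \<rparr>"

lemma pverts_ext_graph [simp]: "pverts (ext_graph g m) = {..<3 * g + 2 * m}"
  by (simp add: ext_graph_def)

lemma parcs_ext_graph:
  "(u, v) \<in> parcs (ext_graph g m) \<longleftrightarrow> fwd_edge g m u v \<or> fwd_edge g m v u"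
  by (simp add: ext_graph_def)

lemma pair_graph_ext_graph: "pair_graph (ext_graph g m)"
proof -
  let ?G = "ext_graph g m"
  have sub: "parcs ?G \<subseteq> {..<3 * g + 2 * m} \<times> {..<3 * g + 2 * m}"
    by (auto simp: parcs_ext_graph fwd_edge_def)
  then have "finite (parcs ?G)"
    by (rule finite_subset) simp
  then show ?thesis
    using sub
    by unfold_locales
      (auto simp: symmetric_def sym_def parcs_ext_graph fwd_edge_def)
qed

lemma pair_fin_digraph_ext_graph: "pair_fin_digraph (ext_graph g m)"
  using pair_graph_ext_graph
  by (simp add: pair_graph_def pair_digraph_def)

lemma pair_wf_digraph_ext_graph: "pair_wf_digraph (ext_graph g m)"
  using pair_fin_digraph_ext_graph by (simp add: pair_fin_digraph_def)

text \<open>Every vertex lies in the clique or has a neighbour there, so any two are joined through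
  the clique vertex \<open>0\<close>.\<close>

lemma connected_ext_graph:
  assumes "g \<ge> 1"
  shows "Digraph_Component.connected (with_proj (ext_graph g m))"
proof -
  let ?G = "ext_graph g m"
  let ?R = "rtrancl_on (pverts ?G) ((parcs ?G)\<^sup>s)"
  have edge: "(u, v) \<in> ?R" if "(u, v) \<in> parcs ?G" for u v
    using that pair_wf_digraph.in_arcsD1[OF pair_wf_digraph_ext_graph that]
      pair_wf_digraph.in_arcsD2[OF pair_wf_digraph_ext_graph that]
    by (intro rtrancl_on_into_rtrancl_on[OF rtrancl_on_refl]) (auto simp: symcl_def)
  have sym: "(v, u) \<in> parcs ?G" if "(u, v) \<in> parcs ?G" for u v
    using that by (auto simp: parcs_ext_graph)
  have hub: "(0, v) \<in> ?R \<and> (v, 0) \<in> ?R" if "v \<in> pverts ?G" for v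
  proof -
    have clq: "(0, c) \<in> ?R \<and> (c, 0) \<in> ?R" if "c < g + m" for c
    proof (cases "c = 0")
      case True
      then show ?thesis using assms by auto
    next
      case False
      then have "(0, c) \<in> parcs ?G" using that by (simp add: parcs_ext_graph fwd_edge_def)
      then show ?thesis using edge sym by blast
    qed
    have v: "v < 3 * g + 2 * m"
      using that by simp
    have "\<exists>c < g + m. v = c \<or> (c, v) \<in> parcs ?G"
    proof -
      consider "v < g + m" | "g + m \<le> v" "v < g + 2 * m" | "g + 2 * m \<le> v" "v < 2 * g + 2 * m"
        | "2 * g + 2 * m \<le> v" "v < 3 * g + 2 * m"
        using v by linarith
      then show ?thesis
      proof cases
        case 2
        \<comment> \<open>For $v = x_j$ the clique neighbour \<open>v - m\<close> is $b_j$; the leaf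
          cases below subtract the offset of the leaf block to recover $a_i$.\<close>
        then show ?thesis
          by (intro exI[of _ "v - m"]) (auto simp: parcs_ext_graph fwd_edge_def)
      next
        case 3
        then show ?thesis
          by (intro exI[of _ "v - (g + 2 * m)"]) (auto simp: parcs_ext_graph fwd_edge_def)
      next
        case 4
        then show ?thesis
          by (intro exI[of _ "v - (2 * g + 2 * m)"]) (auto simp: parcs_ext_graph fwd_edge_def)
      qed auto
    qed
    then obtain c where c: "c < g + m" "v = c \<or> (c, v) \<in> parcs ?G" by blast
    then show ?thesis
      using clq[OF c(1)] edge[of c v] edge[of v c] sym[of c v]
      by (meson rtrancl_on_trans)
  qed
  then have "\<forall>u\<in>pverts ?G. \<forall>v\<in>pverts ?G. (u, v) \<in> ?R"
    by (meson rtrancl_on_trans)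
  moreover have "0 \<in> pverts ?G"
    using assms by simp
  ultimately show ?thesis
    unfolding connected_conv with_proj_simps by blast
qed

lemma split_partition_ext_graph:
  assumes "g \<ge> 1"
  shows "\<exists>C I. split_partition (ext_graph g m) C I"
proof (cases "g = 1 \<and> m = 0")
  case True
  \<comment> \<open>For the path on three vertices the clique \<open>{0}\<close> is not maximum.\<close>
  then have "split_partition (ext_graph g m) {0, 1} {2}"
    by (intro split_partitionI)
      (auto simp: clique_def independent_set_def parcs_ext_graph fwd_edge_def)
  then show ?thesis by blast
next
  case False
  have "split_partition (ext_graph g m) {..<g + m} {g + m..<3 * g + 2 * m}"
  proof (rule split_partitionI)
    fix y assume y: "y \<in> {g + m..<3 * g + 2 * m}"
    \<comment> \<open>Vertex \<open>1\<close> is $a_1$, or $b_0$ if $g = 1$. A leaf has only one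
      neighbour and no $x_j$ is adjacent to $a_0$.\<close>
    have "(y, 0) \<notin> parcs (ext_graph g m) \<or> (y, 1) \<notin> parcs (ext_graph g m)"
      using y assms False by (auto simp: parcs_ext_graph fwd_edge_def)
    moreover have "{0, 1} \<subseteq> {..<g + m}"
      using assms False by auto
    ultimately show "\<exists>c\<in>{..<g + m}. (y, c) \<notin> parcs (ext_graph g m)"
      by blast
  qed (use assms in \<open>auto simp: clique_def independent_set_def parcs_ext_graph fwd_edge_def\<close>)
  then show ?thesis by blast
qed

section \<open>Size and position of power dominating sets\<close>

lemma power_dominating_set_meets_triple:
  assumes S: "power_dominating_set (ext_graph g m) S" and i: "i < g"
  shows "S \<inter> {i, g + 2 * m + i, 2 * g + 2 * m + i} \<noteq> {}"
proof
  let ?G = "ext_graph g m" and ?y = "g + 2 * m + i" and ?z = "2 * g + 2 * m + i"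
  assume disj: "S \<inter> {i, ?y, ?z} = {}"
  have nbr: "u = i" if "(u, ?y) \<in> parcs ?G \<or> (u, ?z) \<in> parcs ?G" for u
    using that i by (auto simp: parcs_ext_graph fwd_edge_def)
  have "{?y, ?z} \<inter> observed ?G S n = {}" for n
  proof (induction n)
    case (Suc n)
    show ?case
    \<comment> \<open>Index \<open>Suc 0\<close> is the domination step, not a propagation from the
      dummy value at \<open>0\<close>.\<close>
    proof (cases "n = 0")
      case True
      then show ?thesis using disj nbr by (auto simp: closed_nbhd_set_iff)
    next
      case False
      have "{?y, ?z} \<subseteq> closed_nbhd ?G i - observed ?G S n"
        using Suc i by (auto simp: closed_nbhd_def parcs_ext_graph fwd_edge_def)
      then have blocked: "\<not> card (closed_nbhd ?G i - observed ?G S n) \<le> 1"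
        using i by (intro not_propagating[OF pair_fin_digraph_ext_graph]) auto
      have "v \<notin> observed ?G S (Suc n)" if v: "v \<in> {?y, ?z}" for v
      proof
        assume "v \<in> observed ?G S (Suc n)"
        moreover have "n \<ge> 1" using False by simp
        ultimately show False
        proof (cases rule: observed_Suc_cases)
          case (propagated u)
          then show ?thesis using nbr[of u] v blocked by blast
        qed (use Suc v in auto)
      qed
      then show ?thesis by blast
    qed
  qed simp
  moreover obtain n where "observed ?G S n = pverts ?G"
    using S by (auto simp: power_dominating_set_def)
  ultimately have "?y \<notin> pverts ?G" by blast
  then show False using i by simp
qed

text \<open>The $g$ triples are disjoint and contain no $b_k$ or $x_j$, so \<open>S\<close> has at
  least $g$ vertices outside these; if it has only $g$ in all, none is left for them.\<close>

lemma power_dominating_set_card: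
  assumes S: "power_dominating_set (ext_graph g m) S"
  shows "g \<le> card S" and "card S = g \<Longrightarrow> S \<inter> {g..<g + 2 * m} = {}"
proof -
  have fin: "finite S"
    using S by (auto simp: power_dominating_set_def intro: finite_subset)
  define T where "T = S - {g..<g + 2 * m}"
  \<comment> \<open>On \<open>T\<close>, \<open>f\<close> gives the index of the triple containing
    the vertex.\<close>
  define f where "f v = (if v < g then v
    else if v < 2 * g + 2 * m then v - (g + 2 * m) else v - (2 * g + 2 * m))" for v
  have "i \<in> f ` T" if i: "i < g" for i
  proof -
    obtain v where "v \<in> S" "v \<in> {i, g + 2 * m + i, 2 * g + 2 * m + i}"
      using power_dominating_set_meets_triple[OF S i] by blast
    then have "v \<in> T" "f v = i"
      using i by (auto simp: T_def f_def)
    then show ?thesis by blast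
  qed
  then have "{..<g} \<subseteq> f ` T" by blast
  then have gT: "g \<le> card T"
    using surj_card_le[of T "{..<g}" f] fin by (simp add: T_def)
  then show "g \<le> card S"
    using card_mono[OF fin, of T] by (auto simp: T_def)
  assume "card S = g"
  then have "T = S"
    using gT fin by (intro card_seteq) (auto simp: T_def)
  then show "S \<inter> {g..<g + 2 * m} = {}"
    by (auto simp: T_def)
qed

section \<open>Speed of propagation along the half graph\<close>

lemma observed_half_graph_delay:
  assumes S: "S \<inter> {g..<g + 2 * m} = {}"
  shows "observed (ext_graph g m) S (Suc i) \<inter> {g + m + i..<g + 2 * m} = {}"
proof (induction i)
  case 0
  show ?case
    using S by (fastforce simp: closed_nbhd_set_iff parcs_ext_graph fwd_edge_def)
next
  case (Suc i)
  let ?G = "ext_graph g m" and ?P = "observed (ext_graph g m) S (Suc i)"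
  have "v \<notin> observed ?G S (Suc (Suc i))" if v: "g + m + Suc i \<le> v" "v < g + 2 * m" for v
  proof
    assume "v \<in> observed ?G S (Suc (Suc i))"
    moreover have "Suc i \<ge> 1" by simp
    ultimately show False
    proof (cases rule: observed_Suc_cases)
      case observed
      then show ?thesis using Suc v by auto
    next
      case (propagated u)
      then have u: "g \<le> u" "u < g + m" "v \<le> u + m"
        using v by (auto simp: parcs_ext_graph fwd_edge_def)
      \<comment> \<open>For $v = x_j$ the vertex \<open>u\<close> is some $b_k$ with $k \<ge> j >
        i$, hence adjacent to both $x_i$ and $x_{i+1}$, which are still unobserved.\<close>
      then have "{g + m + i, g + m + Suc i} \<subseteq> closed_nbhd ?G u - ?P"
        using Suc v by (auto simp: closed_nbhd_def parcs_ext_graph fwd_edge_def)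
      then have "\<not> card (closed_nbhd ?G u - ?P) \<le> 1"
        by (intro not_propagating[OF pair_fin_digraph_ext_graph]) auto
      then show ?thesis using propagated by simp
    qed
  qed
  then show ?case by (force simp: disjoint_iff)
qed

text \<open>Matches the delay bound from the other side. As the $x_j$ are numbered directly after
  the clique, the clique and the first \<open>i\<close> of them form an initial segment.\<close>

lemma observed_hubs_lower:
  assumes g: "g \<ge> 1" and i: "i \<le> m"
  shows "{..<g + m + i} \<union> {g + 2 * m..<3 * g + 2 * m} \<subseteq> observed (ext_graph g m) {..<g} (Suc i)"
  using i
proof (induction i)
  case 0
  have "v \<in> closed_nbhd_set (ext_graph g m) {..<g}"
    if v: "v < g + m \<or> g + 2 * m \<le> v \<and> v < 3 * g + 2 * m" for v
  proof -
    consider "v < g" | "g \<le> v" "v < g + m" | "g + 2 * m \<le> v" "v < 2 * g + 2 * m"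
      | "2 * g + 2 * m \<le> v" "v < 3 * g + 2 * m"
      using v by linarith
    then show ?thesis
    proof cases
      case 2
      then have "(0, v) \<in> parcs (ext_graph g m)"
        using g by (simp add: parcs_ext_graph fwd_edge_def)
      then show ?thesis using g by (auto simp: closed_nbhd_set_iff)
    next
      case 3
      then show ?thesis
        by (auto simp: closed_nbhd_set_iff parcs_ext_graph fwd_edge_def
            intro!: bexI[of _ "v - (g + 2 * m)"])
    next
      case 4
      then show ?thesis
        by (auto simp: closed_nbhd_set_iff parcs_ext_graph fwd_edge_def
            intro!: bexI[of _ "v - (2 * g + 2 * m)"])
    qed (simp add: closed_nbhd_set_iff)
  qed
  then show ?case by auto
next
  case (Suc i)
  let ?G = "ext_graph g m" and ?P = "observed (ext_graph g m) {..<g} (Suc i)"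
  have sub: "{..<g + m + i} \<union> {g + 2 * m..<3 * g + 2 * m} \<subseteq> ?P"
    using Suc by simp
  have "closed_nbhd ?G (g + i) \<subseteq> insert (g + m + i) {..<g + m + i}"
    using Suc.prems by (auto simp: closed_nbhd_def parcs_ext_graph fwd_edge_def)
  then have "closed_nbhd ?G (g + i) - ?P \<subseteq> {g + m + i}"
    using sub by blast
  then have "card (closed_nbhd ?G (g + i) - ?P) \<le> card {g + m + i}"
    by (rule card_mono[rotated]) simp
  moreover have "g + i \<in> ?P"
    using sub Suc.prems by auto
  ultimately have "g + i \<in> propagating ?G ?P"
    by (simp add: propagating_def)
  moreover have "(g + i, g + m + i) \<in> parcs ?G"
    using Suc.prems by (auto simp: parcs_ext_graph fwd_edge_def)
  ultimately have "g + m + i \<in> observed ?G {..<g} (Suc (Suc i))"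
    by (auto simp: closed_nbhd_set_iff)
  moreover have "?P \<subseteq> observed ?G {..<g} (Suc (Suc i))"
    by simp
  ultimately show ?case
    using sub by (auto simp: less_Suc_eq)
qed

lemma observed_hubs:
  assumes "g \<ge> 1"
  shows "observed (ext_graph g m) {..<g} (Suc m) = pverts (ext_graph g m)"
proof
  show "observed (ext_graph g m) {..<g} (Suc m) \<subseteq> pverts (ext_graph g m)"
    by (intro observed_subset_pverts[OF pair_wf_digraph_ext_graph]) auto
  show "pverts (ext_graph g m) \<subseteq> observed (ext_graph g m) {..<g} (Suc m)"
    using observed_hubs_lower[OF assms, of m m] by (auto simp: subset_iff not_less)
qed

lemma power_dominating_set_hubs:
  assumes "g \<ge> 1"
  shows "power_dominating_set (ext_graph g m) {..<g}"
  unfolding power_dominating_set_def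
  using observed_hubs[OF assms] by (auto intro!: exI[of _ "Suc m"])

section \<open>The two parameters of the graph\<close>

lemma power_domination_number_ext_graph:
  assumes "g \<ge> 1"
  shows "power_domination_number (ext_graph g m) = g"
  unfolding power_domination_number_def
proof (rule Least_equality)
  show "\<exists>S. power_dominating_set (ext_graph g m) S \<and> card S = g"
    using power_dominating_set_hubs[OF assms] by (intro exI[of _ "{..<g}"]) simp
qed (use power_dominating_set_card(1) in blast)

lemma observed_all_delay:
  assumes S: "power_dominating_set (ext_graph g m) S" "card S = g"
    and i: "i \<ge> 1" "observed (ext_graph g m) S i = pverts (ext_graph g m)"
  shows "Suc m \<le> i"
proof (rule ccontr)
  assume "\<not> Suc m \<le> i"
  \<comment> \<open>At index \<open>i\<close> only $i - 1$ propagation steps have happened, so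
    $x_{i-1}$ is unobserved; it exists because $i \<le> m$.\<close>
  then have lt: "g + m + (i - 1) < g + 2 * m"
    using i(1) by simp
  have "observed (ext_graph g m) S i \<inter> {g + m + (i - 1)..<g + 2 * m} = {}"
    using observed_half_graph_delay[OF power_dominating_set_card(2)[OF S], of "i - 1"] i(1)
    by simp
  then have "g + m + (i - 1) \<notin> observed (ext_graph g m) S i"
    using lt by fastforce
  then have "g + m + (i - 1) \<notin> pverts (ext_graph g m)"
    using i(2) by simp
  then show False
    using lt by simp
qed

lemma propagation_radius_ext_graph:
  assumes "g \<ge> 1"
  shows "propagation_radius (ext_graph g m) = Suc m"
  unfolding propagation_radius_def power_domination_number_ext_graph[OF assms]
proof (rule Least_equality)
  let ?G = "ext_graph g m"
  note pds = power_dominating_set_hubs[OF assms, of m]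
  have "pds_radius ?G {..<g} = Suc m"
    unfolding pds_radius_def
    using observed_hubs[OF assms] observed_all_delay[OF pds]
    by (intro Least_equality) auto
  then show "\<exists>S. power_dominating_set ?G S \<and> card S = g \<and> pds_radius ?G S = Suc m"
    using pds by (intro exI[of _ "{..<g}"]) simp
next
  let ?G = "ext_graph g m"
  fix r assume "\<exists>S. power_dominating_set ?G S \<and> card S = g \<and> pds_radius ?G S = r"
  then obtain S where S: "power_dominating_set ?G S" "card S = g" "pds_radius ?G S = r"
    by blast
  \<comment> \<open>Some index must be known to work before the \<open>LEAST\<close> in
    \<open>pds_radius\<close> can be used as one.\<close>
  then have "\<exists>i. i \<ge> 1 \<and> observed ?G S i = pverts ?G"
    by (auto simp: power_dominating_set_def)
  then have "r \<ge> 1 \<and> observed ?G S r = pverts ?G"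
    using LeastI_ex S(3) unfolding pds_radius_def by (metis (mono_tags, lifting))
  then show "Suc m \<le> r"
    using observed_all_delay[OF S(1,2)] by blast
qed

theorem mainTheorem6:
  fixes p g :: nat
  assumes "p \<ge> 1" and "g \<ge> 1"
  shows "\<exists>G :: nat pair_pre_digraph.
           connected_split_graph G \<and>
           card (pverts G) = 3 * g + 2 * p - 2 \<and>
           power_domination_number G = g \<and>
           propagation_radius G = p \<and>
           real (propagation_radius G) =
             (real (card (pverts G)) - 3 * real (power_domination_number G)) / 2 + 1"
proof -
  \<comment> \<open>With $m = p - 1$ the order $3g + 2m$ becomes $3g + 2p - 2$, and the quotient in
    the formula is $m$.\<close>
  obtain m where p: "p = Suc m"
    using assms(1) by (cases p) auto
  have "connected_split_graph (ext_graph g m)"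
    using assms(2) pair_graph_ext_graph connected_ext_graph split_partition_ext_graph
    by (simp add: connected_split_graph_def)
  then show ?thesis
    using assms(2) p
    by (intro exI[of _ "ext_graph g m"])
      (simp add: power_domination_number_ext_graph propagation_radius_ext_graph)
qed

end
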